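(* Let $r=r(n)$ be an integer-valued function with $r\ge 5$ and $r=o(n^{1/8})$. Let $G(n,r,1)$ be the graph on $[n]^{(r)}$ in which two $r$-subsets are adjacent iff they intersect in exactly one element. For an independent set $A$ of $G(n,r,1)$ let $d(A)=\max_{x\neq y}|\{v\in A: \{x,y\}\subset v\}|$. If $A$ is an independent set in $G(n,r,1)$ with $d(A)\le \binom{tn-2}{r-2}$ for some $t\in(0,1)$, then $$|A|\le \frac{1}{t}\binom{tn-2}{r-2}+o\left(\binom{n-2}{r-2}\right),$$ where the $o(\cdot)$ term is as $n\to\infty$ and does not depend on the particular set $A$.
   Context: For a real number $a$ and a nonnegative integer $b$, $\binom{a}{b}$ is defined as $\frac{a(a-1)\cdots(a-b+1)}{b!}$ (this is used when $tn$ is not an integer). The star centered at distinct elements $x,y$ over $[n]$ is the family of all $r$-subsets of $[n]$ containing both $x$ and $y$; $d(A)$ is the largest size of the intersection of $A$ with a star. *)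

theory Defs
  imports Complex_Main "HOL-Library.Landau_Symbols"
begin

definition rsets :: "nat \<Rightarrow> nat \<Rightarrow> nat set set" where
  "rsets n r = {v. v \<subseteq> {1..n} \<and> card v = r}"

definition indep_Gnr1 :: "nat \<Rightarrow> nat \<Rightarrow> nat set set \<Rightarrow> bool" where
  "indep_Gnr1 n r A \<longleftrightarrow> A \<subseteq> rsets n r \<and>
     (\<forall>u\<in>A. \<forall>v\<in>A. card (u \<inter> v) \<noteq> 1)"

definition dA :: "nat \<Rightarrow> nat set set \<Rightarrow> nat" where
  "dA n A = Max (insert 0 {card {v\<in>A. x \<in> v \<and> y \<in> v} | x y.
                 x \<in> {1..n} \<and> y \<in> {1..n} \<and> x \<noteq> y})"

end

theory Submission
  imports Defs
begin

text \<open>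
  Call T a kernel if no set of at most r points outside T meets all members of A containing T.
  A kernel meets no member of A, and no other small kernel, in exactly one point. Hence the
  kernels of size 2 are pairwise disjoint, and so are the clusters formed from such a pair P by
  adding all x for which P + x is a kernel. A cluster with a points holds at most
  min(binom(a-2, r-2), d(A)) sets between P and the cluster; as binom(x-2, r-2) / x increases
  and the clusters are disjoint subsets of [n], these sets together give the main term.

  The other members of A are rare. If some point of w lies in no kernel of size 2 or 3, successive
  blocking sets place one of n r^3 four-sets inside w. Otherwise every point of w has an
  out-neighbour in w for a digraph of out-degree at most 3r (the neighbours come from kernel pairs
  and triples), and this forces into w a set of size s = 4, 5 or 6 spanned by only s - 3 freely
  chosen points and three neighbours. Fixing s points costs a factor (r/n)^(s-2), while there are
  only O(n^(s-3)) poly(r) such sets, so at most 298 (r^7/n) binom(n-2, r-2) sets are lost, for every n.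
\<close>

section \<open>Counting \<open>r\<close>-sets through a fixed small set\<close>

text \<open>Each further fixed point multiplies the binomial by \<open>(r - k) / (n - k)\<close>,
  which is at most \<open>r / n\<close> because \<open>r \<le> n\<close>. Products replace quotients
  so that everything stays in \<open>nat\<close>.\<close>

lemma binomial_diff_mult_le:
  fixes n r k :: nat
  assumes "2 \<le> k" "k \<le> r" "r \<le> n"
  shows "((n - k) choose (r - k)) * n ^ (k - 2) \<le> r ^ (k - 2) * ((n - 2) choose (r - 2))"
  using assms
proof (induction k rule: dec_induct)
  case base
  then show ?case by simp
next
  case (step k)
  let ?b = "(n - k) choose (r - k)" and ?b' = "(n - Suc k) choose (r - Suc k)"
  have "(n - k) * ?b' = (r - k) * ?b"
    using step.prems times_binomial_minus1_eq[of "r - k" "n - k"] by (simp add: Suc_diff_Suc)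
  then have "(n - k) * (n * ?b') = n * (r - k) * ?b"
    by (metis mult.assoc mult.left_commute)
  also have "n * (r - k) \<le> r * (n - k)"
    using step.prems mult_le_mono2[of r n k]
    by (simp add: diff_mult_distrib2 mult.commute diff_le_mono2)
  then have "n * (r - k) * ?b \<le> (n - k) * (r * ?b)"
    by (metis mult.assoc mult.commute mult_le_mono1)
  finally have *: "n * ?b' \<le> r * ?b"
    using step.prems by simp
  have exp: "Suc k - 2 = Suc (k - 2)"
    using step.hyps by simp
  have "?b' * n ^ (Suc k - 2) = n * ?b' * n ^ (k - 2)"
    by (simp only: exp power_Suc ac_simps)
  also have "\<dots> \<le> r * ?b * n ^ (k - 2)"
    using * by (rule mult_le_mono1)
  also have "\<dots> = r * (?b * n ^ (k - 2))"
    by simp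
  also have "\<dots> \<le> r * (r ^ (k - 2) * ((n - 2) choose (r - 2)))"
    using step by (intro mult_le_mono2) simp
  also have "\<dots> = r ^ (Suc k - 2) * ((n - 2) choose (r - 2))"
    by (simp only: exp power_Suc ac_simps)
  finally show ?case .
qed

lemma finite_rsets [simp]: "finite (rsets n r)"
  by (rule finite_subset[of _ "Pow {1..n}"]) (auto simp: rsets_def)

lemma card_subsets_between:
  fixes K S :: "'a set"
  assumes "finite S" "K \<subseteq> S"
  shows "card {w. K \<subseteq> w \<and> w \<subseteq> S \<and> card w = r} \<le> (card S - card K) choose (r - card K)"
proof -
  have fK: "finite K"
    using assms finite_subset by blast
  have "card {w. K \<subseteq> w \<and> w \<subseteq> S \<and> card w = r}
          \<le> card {B. B \<subseteq> S - K \<and> card B = r - card K}"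
  proof (rule card_inj_on_le)
    show "inj_on (\<lambda>w. w - K) {w. K \<subseteq> w \<and> w \<subseteq> S \<and> card w = r}"
      by (rule inj_onI) blast
    show "(\<lambda>w. w - K) ` {w. K \<subseteq> w \<and> w \<subseteq> S \<and> card w = r}
            \<subseteq> {B. B \<subseteq> S - K \<and> card B = r - card K}"
      using fK by (auto simp: card_Diff_subset)
    show "finite {B. B \<subseteq> S - K \<and> card B = r - card K}"
      by (rule finite_subset[of _ "Pow S"]) (use assms in auto)
  qed
  then show ?thesis
    using assms fK by (simp add: n_subsets card_Diff_subset)
qed

lemma card_rsets_superset:
  assumes "2 \<le> card K"
  shows "card {w \<in> rsets n r. K \<subseteq> w} * n ^ (card K - 2)
           \<le> r ^ (card K - 2) * ((n - 2) choose (r - 2))"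
proof (cases "{w \<in> rsets n r. K \<subseteq> w} = {}")
  case True
  then show ?thesis by (simp only: card.empty)
next
  case False
  \<comment> \<open>Any counted set supplies \<open>card K \<le> r\<close> and
    \<open>r \<le> n\<close>, which the binomial estimate requires.\<close>
  then obtain w where w: "w \<subseteq> {1..n}" "card w = r" "K \<subseteq> w"
    by (auto simp: rsets_def)
  have "finite w"
    using w finite_subset by blast
  then have le: "card K \<le> r" "r \<le> n"
    using w card_mono[of w K] card_mono[of "{1..n}" w] by auto
  have "{w \<in> rsets n r. K \<subseteq> w} = {w. K \<subseteq> w \<and> w \<subseteq> {1..n} \<and> card w = r}"
    by (auto simp: rsets_def)
  then have "card {w \<in> rsets n r. K \<subseteq> w} \<le> (n - card K) choose (r - card K)"
    using w card_subsets_between[of "{1..n}" K r] by auto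
  then show ?thesis
    using binomial_diff_mult_le[OF assms le] by (meson le_trans mult_le_mono1)
qed

text \<open>A union bound in which \<open>I\<close> may index tuples of successive choices: those
  with repeated entries fail \<open>card (f i) = k\<close> and are dropped, so choices can be
  counted without enforcing distinctness.\<close>

lemma card_rsets_cover:
  assumes B: "B \<subseteq> rsets n r" and I: "finite I" "card I \<le> M" and k: "2 \<le> k"
    and cov: "\<And>w. w \<in> B \<Longrightarrow> \<exists>i\<in>I. card (f i) = k \<and> f i \<subseteq> w"
  shows "card B * n ^ (k - 2) \<le> M * (r ^ (k - 2) * ((n - 2) choose (r - 2)))"
proof -
  let ?J = "{i \<in> I. card (f i) = k}"
  let ?U = "\<lambda>i. {w \<in> rsets n r. f i \<subseteq> w}"
  have "B \<subseteq> (\<Union>i\<in>?J. ?U i)"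
    using B cov by blast
  then have "card B \<le> card (\<Union>i\<in>?J. ?U i)"
    using I by (intro card_mono) auto
  also have "\<dots> \<le> (\<Sum>i\<in>?J. card (?U i))"
    using I by (intro card_UN_le) auto
  finally have "card B * n ^ (k - 2) \<le> (\<Sum>i\<in>?J. card (?U i) * n ^ (k - 2))"
    by (simp add: sum_distrib_right[symmetric])
  also have "\<dots> \<le> (\<Sum>i\<in>?J. r ^ (k - 2) * ((n - 2) choose (r - 2)))"
    using k card_rsets_superset[of "f _" n r] by (intro sum_mono) auto
  also have "\<dots> \<le> M * (r ^ (k - 2) * ((n - 2) choose (r - 2)))"
    using I card_mono[of I ?J] by (simp only: sum_constant of_nat_id) (intro mult_le_mono1, auto)
  finally show ?thesis .
qed

lemma card_Sigma_le:
  assumes "finite I" "card I \<le> a" "\<And>i. i \<in> I \<Longrightarrow> finite (F i) \<and> card (F i) \<le> b"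
  shows "finite (Sigma I F)" "card (Sigma I F) \<le> a * b"
proof -
  show "finite (Sigma I F)"
    using assms by blast
  have "card (Sigma I F) = (\<Sum>i\<in>I. card (F i))"
    using assms by (simp add: card_SigmaI)
  also have "\<dots> \<le> card I * b"
    using assms sum_bounded_above[of I "\<lambda>i. card (F i)" b] by simp
  finally show "card (Sigma I F) \<le> a * b"
    using assms(2) by (meson le_trans mult_le_mono1)
qed

section \<open>Growth of binomials and the size of stars\<close>

text \<open>Up to the factor \<open>fact k\<close>, the binomial at \<open>x - 2\<close> is
  \<open>(x - 2) * Q (x - 2)\<close>. Both \<open>(x - 2) / x\<close> and the nonnegative product
  \<open>Q (x - 2)\<close> grow with \<open>x\<close> from \<open>k + 2\<close> on. The point
  \<open>s\<close> is real because it will be \<open>t * n\<close>.\<close>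

lemma gbinomial_scaling_le:
  fixes a k :: nat and s :: real
  assumes k: "1 \<le> k" and a: "k + 2 \<le> a" and s: "real a \<le> s"
  shows "s * real ((a - 2) choose k) \<le> real a * ((s - 2) gchoose k)"
proof -
  define Q where "Q x = (\<Prod>i = Suc 0..<k. x - real i)" for x :: real
  have prod: "(x gchoose k) = x * Q x / fact k" for x :: real
    using k by (simp add: gbinomial_prod_rev Q_def prod.atLeast_Suc_lessThan)
  have Q: "0 \<le> Q (real a - 2)" "Q (real a - 2) \<le> Q (s - 2)"
    unfolding Q_def using a s by (auto intro!: prod_nonneg prod_mono)
  have "s * (real a - 2) \<le> real a * (s - 2)"
    using s by (simp add: algebra_simps)
  from mult_mono[OF this Q(2)] have "s * (real a - 2) * Q (real a - 2) \<le> real a * (s - 2) * Q (s - 2)"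
    using Q a s by auto
  moreover have "real ((a - 2) choose k) = (real a - 2) gchoose k"
    using a by (simp add: binomial_gbinomial of_nat_diff)
  ultimately show ?thesis
    by (simp add: prod divide_right_mono mult.assoc)
qed

lemma star_card_le_dA:
  assumes "finite A" "x \<in> {1..n}" "y \<in> {1..n}" "x \<noteq> y"
  shows "card {v \<in> A. x \<in> v \<and> y \<in> v} \<le> dA n A"
proof -
  let ?S = "{card {v \<in> A. x \<in> v \<and> y \<in> v} | x y. x \<in> {1..n} \<and> y \<in> {1..n} \<and> x \<noteq> y}"
  have "?S \<subseteq> {..card A}"
    using assms(1) by (auto intro: card_mono)
  then have "finite ?S"
    using finite_subset by blast
  then show ?thesis
    unfolding dA_def using assms(2-4) by (intro Max_ge) auto
qed

lemma card_2_iff_mem: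
  assumes "card P = 2" "p \<in> P"
  obtains q where "P = {p, q}" "p \<noteq> q"
  using assms by (metis card_2_iff doubleton_eq_iff insertE singletonD)

section \<open>Kernels and blocking sets\<close>

locale indep_family =
  fixes n r :: nat and A :: "nat set set"
  assumes r_ge: "5 \<le> r" and indep: "indep_Gnr1 n r A"
begin

lemma A_rsets: "A \<subseteq> rsets n r"
  and A_inter: "u \<in> A \<Longrightarrow> v \<in> A \<Longrightarrow> card (u \<inter> v) \<noteq> 1"
  using indep by (auto simp: indep_Gnr1_def)

lemma A_memD:
  assumes "w \<in> A"
  shows "w \<subseteq> {1..n}" "card w = r" "finite w"
  using A_rsets assms finite_subset[of w "{1..n}"] by (auto simp: rsets_def)

lemma finite_A: "finite A"
  using A_rsets finite_rsets finite_subset by blast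

text \<open>Equivalently, the link of \<open>T\<close>, formed by the sets \<open>v - T\<close> for
  members \<open>v\<close> of \<open>A\<close> containing \<open>T\<close>, has no transversal of
  size at most \<open>r\<close>. The bound \<open>r\<close> admits \<open>W = w - T\<close> for
  every \<open>w \<in> A\<close>.\<close>

definition kernel :: "nat set \<Rightarrow> bool" where
  "kernel T \<longleftrightarrow> (\<forall>W. finite W \<longrightarrow> card W \<le> r \<longrightarrow> W \<inter> T = {} \<longrightarrow>
     (\<exists>v\<in>A. T \<subseteq> v \<and> v \<inter> W = {}))"

lemma kernelE:
  assumes "kernel T" "finite W" "card W \<le> r" "W \<inter> T = {}"
  obtains v where "v \<in> A" "T \<subseteq> v" "v \<inter> W = {}"
  using assms unfolding kernel_def by blast

lemma kernel_subset: "kernel T \<Longrightarrow> T \<subseteq> {1..n}"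
  using A_memD(1) kernelE[of T "{}"] by (metis card.empty dual_order.trans finite.emptyI inf_bot_left le0)

lemma kernel_finite: "kernel T \<Longrightarrow> finite T"
  using kernel_subset finite_subset by blast

text \<open>A member \<open>v\<close> of \<open>A\<close> that contains \<open>T\<close> and avoids
  \<open>w - T\<close> meets \<open>w\<close> exactly in \<open>T \<inter> w\<close>, and members of
  \<open>A\<close> never share exactly one point.\<close>

lemma kernel_inter_mem:
  assumes "kernel T" "w \<in> A"
  shows "card (T \<inter> w) \<noteq> 1"
proof -
  have "card (w - T) \<le> r"
    using A_memD[OF assms(2)] card_mono[of w "w - T"] by auto
  then obtain v where v: "v \<in> A" "T \<subseteq> v" "v \<inter> (w - T) = {}"
    using kernelE[OF assms(1), of "w - T"] A_memD(3)[OF assms(2)] by auto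
  then have "v \<inter> w = T \<inter> w"
    by blast
  then show ?thesis
    using A_inter[OF v(1) assms(2)] by simp
qed

text \<open>The same argument with \<open>W = T' - T\<close>, which has at most
  \<open>3 \<le> r\<close> points: the resulting member of \<open>A\<close> meets the kernel
  \<open>T'\<close> exactly in \<open>T \<inter> T'\<close>.\<close>

lemma kernel_inter_kernel:
  assumes "kernel T" "kernel T'" "card T' \<le> 3"
  shows "card (T \<inter> T') \<noteq> 1"
proof -
  have fT': "finite T'"
    using assms(2) kernel_finite by blast
  then have "card (T' - T) \<le> r"
    using assms(3) r_ge card_mono[of T' "T' - T"] by auto
  then obtain v where v: "v \<in> A" "T \<subseteq> v" "v \<inter> (T' - T) = {}"
    using kernelE[OF assms(1), of "T' - T"] fT' by auto
  then have "T' \<inter> v = T \<inter> T'"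
    by blast
  then show ?thesis
    using kernel_inter_mem[OF assms(2) v(1)] by simp
qed

text \<open>A fixed witness that \<open>T\<close> is not a kernel, arbitrary otherwise. It drives a
  branching: a member of \<open>A\<close> containing a non-kernel \<open>T\<close> contains one of
  at most \<open>r\<close> prescribed further points.\<close>

definition blocker :: "nat set \<Rightarrow> nat set" where
  "blocker T = (SOME W. finite W \<and> card W \<le> r \<and> W \<inter> T = {} \<and>
     (\<forall>v\<in>A. T \<subseteq> v \<longrightarrow> v \<inter> W \<noteq> {}))"

lemma blocker:
  assumes "\<not> kernel T"
  shows "finite (blocker T)" "card (blocker T) \<le> r" "blocker T \<inter> T = {}"
    "\<And>v. v \<in> A \<Longrightarrow> T \<subseteq> v \<Longrightarrow> v \<inter> blocker T \<noteq> {}"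
proof -
  have "\<exists>W. finite W \<and> card W \<le> r \<and> W \<inter> T = {} \<and> (\<forall>v\<in>A. T \<subseteq> v \<longrightarrow> v \<inter> W \<noteq> {})"
    using assms by (simp add: kernel_def)
  from someI_ex[OF this, folded blocker_def]
  show "finite (blocker T)" "card (blocker T) \<le> r" "blocker T \<inter> T = {}"
    "\<And>v. v \<in> A \<Longrightarrow> T \<subseteq> v \<Longrightarrow> v \<inter> blocker T \<noteq> {}"
    by simp_all
qed

section \<open>Kernel pairs and their clusters\<close>

definition kpairs :: "nat set set" where
  "kpairs = {P. kernel P \<and> card P = 2}"

definition cluster :: "nat set \<Rightarrow> nat set" where
  "cluster P = {x. kernel (insert x P)}"

lemma kpairsD: "P \<in> kpairs \<Longrightarrow> kernel P" "P \<in> kpairs \<Longrightarrow> card P = 2"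
  by (auto simp: kpairs_def)

lemma subset_cluster: "P \<in> kpairs \<Longrightarrow> P \<subseteq> cluster P"
  by (auto simp: kpairs_def cluster_def insert_absorb)

lemma cluster_subset: "cluster P \<subseteq> {1..n}"
  using kernel_subset by (fastforce simp: cluster_def)

lemma finite_kpairs: "finite kpairs"
  using kernel_subset by - (rule finite_subset[of _ "Pow {1..n}"], auto simp: kpairs_def)

lemma kernel_pair_subset:
  assumes "P \<in> kpairs" "card (P \<inter> w) \<noteq> 1" "P \<inter> w \<noteq> {}"
  shows "P \<subseteq> w"
proof -
  have P: "card P = 2" "finite P"
    using assms(1) kpairsD kernel_finite by auto
  then have "card (P \<inter> w) \<noteq> 0" "card (P \<inter> w) \<le> 2"
    using assms(3) card_mono[of P "P \<inter> w"] by auto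
  then have "card (P \<inter> w) = card P"
    using assms(2) P by linarith
  then show ?thesis
    using P card_subset_eq[of P "P \<inter> w"] by blast
qed

lemma kpairs_disjoint:
  assumes "P \<in> kpairs" "Q \<in> kpairs" "P \<noteq> Q"
  shows "P \<inter> Q = {}"
proof (rule ccontr)
  assume ne: "P \<inter> Q \<noteq> {}"
  have "card (P \<inter> Q) \<noteq> 1"
    using assms kernel_inter_kernel[of P Q] by (auto simp: kpairs_def)
  then have "P \<subseteq> Q" "Q \<subseteq> P"
    using assms ne kernel_pair_subset[of P Q] kernel_pair_subset[of Q P] by (auto simp: Int_commute)
  then show False
    using assms by blast
qed

text \<open>Since \<open>P\<close> and \<open>Q\<close> are disjoint, a common point
  \<open>x\<close> would be the only common point of the kernels \<open>insert x P\<close> and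
  \<open>insert x Q\<close>.\<close>

lemma cluster_disjoint:
  assumes "P \<in> kpairs" "Q \<in> kpairs" "P \<noteq> Q"
  shows "cluster P \<inter> cluster Q = {}"
proof (rule ccontr)
  assume "cluster P \<inter> cluster Q \<noteq> {}"
  then obtain x where x: "kernel (insert x P)" "kernel (insert x Q)"
    by (auto simp: cluster_def)
  have "insert x P \<inter> insert x Q = {x}"
    using kpairs_disjoint[OF assms] by blast
  moreover have "card (insert x Q) \<le> 3"
    using assms(2) kernel_finite card_insert_le_m1[of 3 Q x] by (auto simp: kpairs_def)
  ultimately show False
    using kernel_inter_kernel[OF x] by (metis is_singletonI is_singleton_altdef)
qed

text \<open>The kernel \<open>insert x P\<close> cannot meet \<open>w\<close> in \<open>x\<close>
  alone, so \<open>w\<close> meets \<open>P\<close>; the kernel pair \<open>P\<close> cannot meet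
  \<open>w\<close> in one point, so it lies inside.\<close>

lemma cluster_mem:
  assumes "P \<in> kpairs" "w \<in> A" "x \<in> w" "x \<in> cluster P"
  shows "P \<subseteq> w"
proof -
  have "card (insert x P \<inter> w) \<noteq> 1"
    using assms kernel_inter_mem[of "insert x P" w] by (simp add: cluster_def)
  then have "P \<inter> w \<noteq> {}"
    using assms(3) by (auto simp: Int_insert_left)
  then show ?thesis
    using assms kernel_pair_subset kernel_inter_mem kpairsD(1) by blast
qed

section \<open>The neighbour digraph and its bounded out-degree\<close>

definition nbrs :: "nat \<Rightarrow> nat set" where
  "nbrs x = (if x \<in> \<Union>kpairs then \<Union>{P \<in> kpairs. x \<in> P} - {x}
     else \<Union>{T. kernel T \<and> card T = 3 \<and> x \<in> T} - {x})"

text \<open>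
  A point of a kernel pair has its partner as only neighbour; a further point of the cluster of P
  has exactly the neighbours P. Everywhere else the relation is symmetric.
\<close>

definition rootless :: "nat set" where
  "rootless = {x \<in> {1..n}. \<forall>T. kernel T \<longrightarrow> x \<in> T \<longrightarrow> card T \<noteq> 2 \<and> card T \<noteq> 3}"

lemma nbrs_kpair:
  assumes "{p, q} \<in> kpairs" "p \<noteq> q"
  shows "nbrs p = {q}"
proof -
  have "{P \<in> kpairs. p \<in> P} = {{p, q}}"
    using assms kpairs_disjoint by blast
  then show ?thesis
    using assms by (auto simp: nbrs_def)
qed

text \<open>A kernel pair through \<open>u\<close> would differ from \<open>P\<close> and have a
  cluster meeting that of \<open>P\<close>. So \<open>u\<close> lies in no kernel pair, and the
  triple \<open>insert u P\<close> counts for its neighbours.\<close>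

lemma nbrs_cluster:
  assumes "P \<in> kpairs" "u \<in> cluster P" "u \<notin> P"
  shows "P \<subseteq> nbrs u"
proof -
  have "u \<notin> \<Union>kpairs"
    using assms cluster_disjoint subset_cluster by blast
  moreover have "kernel (insert u P)" "card (insert u P) = 3"
    using assms kernel_finite by (auto simp: kpairs_def cluster_def)
  ultimately show ?thesis
    using assms(3) by (auto simp: nbrs_def)
qed

lemma nbrs_sym:
  assumes "x \<notin> \<Union>kpairs" "y \<notin> \<Union>kpairs" "y \<in> nbrs x"
  shows "x \<in> nbrs y"
  using assms by (auto simp: nbrs_def)

text \<open>No edge enters a cluster from outside: a kernel triple through \<open>y\<close> and a
  cluster point \<open>q\<close> must meet \<open>P\<close>, hence contain \<open>P\<close>, hence
  equal \<open>insert y P\<close>, which puts \<open>y\<close> into the cluster.\<close>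

lemma nbrs_outside_cluster:
  assumes P: "P \<in> kpairs" and y: "y \<notin> cluster P"
  shows "nbrs y \<inter> cluster P = {}"
proof (rule ccontr)
  assume "nbrs y \<inter> cluster P \<noteq> {}"
  then obtain q where q: "q \<in> nbrs y" "q \<in> cluster P"
    by blast
  show False
  proof (cases "y \<in> \<Union>kpairs")
    case True
    then obtain Q where Q: "Q \<in> kpairs" "y \<in> Q" "q \<in> Q"
      using q by (auto simp: nbrs_def)
    then have "Q = P"
      using P q cluster_disjoint subset_cluster by blast
    then show False
      using Q y subset_cluster by blast
  next
    case False
    then obtain T where T: "kernel T" "card T = 3" "y \<in> T" "q \<in> T"
      using q by (auto simp: nbrs_def)
    have fT: "finite T"
      using T by (simp add: kernel_finite)
    have "card (insert q P \<inter> T) \<noteq> 1"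
      using kernel_inter_kernel[of "insert q P" T] T q by (simp add: cluster_def)
    then have "P \<inter> T \<noteq> {}"
      using T by auto
    moreover have "card (P \<inter> T) \<noteq> 1"
      using kernel_inter_kernel[of P T] T P kpairsD by simp
    ultimately have PT: "P \<subseteq> T"
      using P kernel_pair_subset by blast
    have "y \<notin> P"
      using y P subset_cluster by blast
    then have "card (insert y P) = card T"
      using P T kernel_finite by (auto simp: kpairs_def)
    then have "insert y P = T"
      using PT T fT card_subset_eq[of T "insert y P"] by auto
    then show False
      using y T by (simp add: cluster_def)
  qed
qed

text \<open>Some kernel of size 2 or 3 used by \<open>nbrs\<close> passes through \<open>x\<close>,
  and it cannot meet \<open>w\<close> in \<open>x\<close> alone.\<close>

lemma nbrs_meets:
  assumes w: "w \<in> A" and x: "x \<in> w" "x \<notin> rootless"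
  obtains y where "y \<in> w" "y \<in> nbrs x" "y \<noteq> x"
proof -
  have *: "\<exists>y \<in> w. y \<in> T \<and> y \<noteq> x" if "kernel T" "x \<in> T" for T
  proof (rule ccontr)
    assume "\<not> ?thesis"
    then have "T \<inter> w = {x}"
      using that x by blast
    then show False
      using kernel_inter_mem[OF that(1) w] by simp
  qed
  show thesis
  proof (cases "x \<in> \<Union>kpairs")
    case True
    then obtain P where "P \<in> kpairs" "x \<in> P"
      by blast
    then show thesis
      using *[of P] True that kpairsD by (auto simp: nbrs_def)
  next
    case False
    have "x \<in> {1..n}"
      using x w A_memD(1) by blast
    then obtain T where "kernel T" "x \<in> T" "card T = 3"
      using x False by (auto simp: rootless_def kpairs_def)
    then show thesis
      using *[of T] False that by (auto simp: nbrs_def)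
  qed
qed

lemma nbrs_finite: "finite (nbrs x)"
proof (rule finite_subset)
  have "nbrs x \<subseteq> \<Union>{T. kernel T}"
    by (auto simp: nbrs_def kpairs_def)
  then show "nbrs x \<subseteq> {1..n}"
    using kernel_subset by blast
qed simp

text \<open>This bound is why \<open>nbrs\<close> ignores triples at a point of a kernel pair, where
  a large cluster would give many of them. Elsewhere fix one triple \<open>T\<close>: every other
  triple \<open>S\<close> through \<open>x\<close> shares a second point \<open>y\<close> with
  \<open>T\<close>, and its third point lies in \<open>blocker {x, y}\<close>. This gives at most
  \<open>2 + 2 * r\<close> neighbours.\<close>

lemma nbrs_card: "card (nbrs x) \<le> 3 * r"
proof (cases "x \<in> \<Union>kpairs")
  case True
  then obtain P where P: "P \<in> kpairs" "x \<in> P"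
    by blast
  then obtain q where "P = {x, q}" "x \<noteq> q"
    using kpairsD(2) card_2_iff_mem by metis
  then show ?thesis
    using P nbrs_kpair r_ge by simp
next
  case False
  show ?thesis
  proof (cases "\<exists>T. kernel T \<and> card T = 3 \<and> x \<in> T")
    case False
    with \<open>x \<notin> \<Union>kpairs\<close> have "nbrs x = {}"
      by (auto simp: nbrs_def)
    then show ?thesis by simp
  next
    case True
    then obtain T where T: "kernel T" "card T = 3" "x \<in> T"
      by blast
    have fT: "finite T"
      using T by (simp add: kernel_finite)
    have nk: "\<not> kernel {x, y}" if "y \<noteq> x" for y
    proof
      assume "kernel {x, y}"
      then have "{x, y} \<in> kpairs"
        using that by (simp add: kpairs_def)
      then show False
        using \<open>x \<notin> \<Union>kpairs\<close> by blast
    qed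
    let ?U = "(T - {x}) \<union> (\<Union>y\<in>T - {x}. blocker {x, y})"
    have "nbrs x \<subseteq> ?U"
    proof
      fix z assume "z \<in> nbrs x"
      then obtain S where S: "kernel S" "card S = 3" "x \<in> S" "z \<in> S" and zx: "z \<noteq> x"
        using False by (auto simp: nbrs_def)
      have "card (S \<inter> T) \<noteq> 1"
        using kernel_inter_kernel S T by simp
      then obtain y where y: "y \<in> S" "y \<in> T" "y \<noteq> x"
        using S T by (metis IntI is_singletonI' is_singleton_altdef Int_iff empty_iff)
      show "z \<in> ?U"
      proof (cases "z = y")
        case True
        then show ?thesis using y by blast
      next
        case False
        have "finite S"
          using S by (simp add: kernel_finite)
        then have "S = {x, y, z}"
          using S y zx False card_subset_eq[of S "{x, y, z}"] by auto
        \<comment> \<open>Otherwise the kernel \<open>S\<close> would yield a member of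
          \<open>A\<close> through \<open>x\<close> and \<open>y\<close> that avoids the
          blocker.\<close>
        moreover have "z \<in> blocker {x, y}"
        proof (rule ccontr)
          assume "z \<notin> blocker {x, y}"
          with \<open>S = {x, y, z}\<close> have "blocker {x, y} \<inter> S = {}"
            using blocker(3)[OF nk[OF y(3)]] by blast
          then obtain v where "v \<in> A" "S \<subseteq> v" "v \<inter> blocker {x, y} = {}"
            using kernelE[OF S(1)] blocker[OF nk[OF y(3)]] by metis
          then show False
            using blocker(4)[OF nk[OF y(3)], of v] S y by blast
        qed
        ultimately show ?thesis
          using y by blast
      qed
    qed
    moreover have fin: "finite ?U"
      using fT blocker(1) nk by auto
    ultimately have "card (nbrs x) \<le> card ?U"
      by (intro card_mono)
    also have "\<dots> \<le> card (T - {x}) + card (\<Union>y\<in>T - {x}. blocker {x, y})"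
      by (rule card_Un_le)
    also have "card (\<Union>y\<in>T - {x}. blocker {x, y}) \<le> (\<Sum>y\<in>T - {x}. card (blocker {x, y}))"
      using fT by (intro card_UN_le) auto
    also have "(\<Sum>y\<in>T - {x}. card (blocker {x, y})) \<le> card (T - {x}) * r"
      using sum_bounded_above[of "T - {x}" "\<lambda>y. card (blocker {x, y})" r] blocker(2) nk by auto
    also have "card (T - {x}) = 2"
      using T fT by simp
    finally show ?thesis
      using r_ge by simp
  qed
qed

section \<open>Generating patterns inside the noncentral members\<close>

definition central :: "nat set set" where
  "central = {w \<in> A. \<exists>P\<in>kpairs. P \<subseteq> w \<and> w \<subseteq> cluster P}"

text \<open>
  In each of the three patterns exactly three of the points are neighbours of earlier ones.
\<close>

definition gen4 :: "nat set \<Rightarrow> bool" where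
  "gen4 w \<longleftrightarrow> (\<exists>x a b c. card {x, a, b, c} = 4 \<and> {x, a, b, c} \<subseteq> w \<and>
     a \<in> nbrs x \<and> b \<in> nbrs x \<union> nbrs a \<and> c \<in> nbrs x \<union> nbrs a \<union> nbrs b)"

definition gen5 :: "nat set \<Rightarrow> bool" where
  "gen5 w \<longleftrightarrow> (\<exists>x a y b c. card {x, a, y, b, c} = 5 \<and> {x, a, y, b, c} \<subseteq> w \<and>
     a \<in> nbrs x \<and> b \<in> nbrs y \<and> c \<in> nbrs x \<union> nbrs a \<union> nbrs y \<union> nbrs b)"

definition gen6 :: "nat set \<Rightarrow> bool" where
  "gen6 w \<longleftrightarrow> (\<exists>x a y b z c. card {x, a, y, b, z, c} = 6 \<and> {x, a, y, b, z, c} \<subseteq> w \<and>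
     a \<in> nbrs x \<and> b \<in> nbrs y \<and> c \<in> nbrs z)"

lemma gen4I:
  assumes "distinct [x, a, b, c]" "set [x, a, b, c] \<subseteq> w"
    "a \<in> nbrs x" "b \<in> nbrs x \<union> nbrs a" "c \<in> nbrs x \<union> nbrs a \<union> nbrs b"
  shows "gen4 w"
  unfolding gen4_def using assms
  by - (rule exI[of _ x], rule exI[of _ a], rule exI[of _ b], rule exI[of _ c], simp)

lemma gen5I:
  assumes "distinct [x, a, y, b, c]" "set [x, a, y, b, c] \<subseteq> w"
    "a \<in> nbrs x" "b \<in> nbrs y" "c \<in> nbrs x \<union> nbrs a \<union> nbrs y \<union> nbrs b"
  shows "gen5 w"
  unfolding gen5_def using assms
  by - (rule exI[of _ x], rule exI[of _ a], rule exI[of _ y], rule exI[of _ b], rule exI[of _ c], simp)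

lemma gen6I:
  assumes "distinct [x, a, y, b, z, c]" "set [x, a, y, b, z, c] \<subseteq> w"
    "a \<in> nbrs x" "b \<in> nbrs y" "c \<in> nbrs z"
  shows "gen6 w"
  unfolding gen6_def using assms
  by - (rule exI[of _ x], rule exI[of _ a], rule exI[of _ y], rule exI[of _ b], rule exI[of _ z], rule exI[of _ c], simp)

lemma fresh_mem:
  assumes "w \<in> A" "length xs < 5"
  obtains z where "z \<in> w" "z \<notin> set xs"
proof -
  have "\<not> w \<subseteq> set xs"
    using assms A_memD[OF assms(1)] r_ge card_mono[of "set xs" w] card_length[of xs] by auto
  then show thesis
    using that by blast
qed

text \<open>As \<open>w\<close> is not central, it has an edge from \<open>y\<close> to
  \<open>y'\<close> outside the cluster. With \<open>P\<close> this makes two free points and two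
  neighbours; one more neighbour comes from a cluster point outside \<open>P\<close>, which points
  to both \<open>p\<close> and \<open>q\<close>, or from the edge leaving a fifth point.\<close>

lemma generated_with_kpair:
  assumes w: "w \<in> A" "w \<inter> rootless = {}" "w \<notin> central" and P: "P \<in> kpairs" "P \<subseteq> w"
  shows "gen5 w \<or> gen6 w"
proof -
  obtain p q where pq: "P = {p, q}" "p \<noteq> q"
    using kpairsD(2)[OF P(1)] by (meson card_2_iff)
  have Npq: "q \<in> nbrs p" "p \<in> nbrs q"
    using nbrs_kpair[of p q] nbrs_kpair[of q p] P pq by (auto simp: insert_commute)
  have out: "\<exists>v\<in>w. v \<in> nbrs u \<and> v \<noteq> u" if "u \<in> w" for u
    using nbrs_meets[OF w(1) that] w(2) that by blast
  have out': "\<exists>v\<in>w. v \<in> nbrs u \<and> v \<noteq> u \<and> v \<notin> cluster P" if "u \<in> w" "u \<notin> cluster P" for u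
    using out[OF that(1)] nbrs_outside_cluster[OF P(1) that(2)] by blast
  obtain y where y: "y \<in> w" "y \<notin> cluster P"
    using w P unfolding central_def by blast
  obtain y' where y': "y' \<in> w" "y' \<in> nbrs y" "y' \<noteq> y" "y' \<notin> cluster P"
    using out'[OF y] by blast
  have cl: "p \<in> cluster P" "q \<in> cluster P" "p \<in> w" "q \<in> w"
    using P pq subset_cluster by blast+
  have d4: "distinct [p, q, y, y']"
    using cl y y' pq by auto
  show ?thesis
  proof (cases "\<exists>u\<in>w. u \<in> cluster P - P")
    case True
    then obtain u where u: "u \<in> w" "u \<in> cluster P" "u \<notin> P"
      by blast
    then have "p \<in> nbrs u" "q \<in> nbrs u"
      using nbrs_cluster[OF P(1)] pq by auto
    then have "gen5 w"
      using d4 u y y' cl pq by (intro gen5I[of u p y y' q]) auto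
    then show ?thesis ..
  next
    case False
    obtain u where u: "u \<in> w" "u \<notin> set [p, q, y, y']"
      using fresh_mem[OF w(1), of "[p, q, y, y']"] by auto
    then have ucl: "u \<notin> cluster P"
      using False pq by auto
    obtain u' where u': "u' \<in> w" "u' \<in> nbrs u" "u' \<noteq> u" "u' \<notin> cluster P"
      using out'[OF u(1) ucl] by blast
    consider "u' \<notin> {y, y'}" | "u' = y" | "u' = y'"
      by blast
    then show ?thesis
    proof cases
      case 1
      then have "gen6 w"
        using d4 u u' y y' cl Npq by (intro gen6I[of p q y y' u u']) auto
      then show ?thesis ..
    next
      case 2
      then have "y \<in> nbrs u"
        using u' by simp
      then have "gen5 w"
        using d4 u y(1) y'(1,2) cl(3,4) Npq(1) by (intro gen5I[of p q u y y']) auto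
      then show ?thesis ..
    next
      case 3
      then have uy': "y' \<in> nbrs u"
        using u' by simp
      obtain y'' where y'': "y'' \<in> w" "y'' \<in> nbrs y'" "y'' \<noteq> y'" "y'' \<notin> cluster P"
        using out'[OF y'(1,4)] by blast
      have "gen5 w"
      proof (cases "y'' = y")
        case True
        then show ?thesis
          using uy' d4 u y(1) y'(1) y''(2) cl(3,4) Npq(1)
          by (intro gen5I[of p q u y' y]) auto
      next
        case False
        moreover have "y'' \<noteq> p" "y'' \<noteq> q"
          using cl y''(4) by auto
        ultimately show ?thesis
          using d4 y(1) y'(1,2) y''(1-3) cl(3,4) Npq(1) by (intro gen5I[of p q y y' y'']) auto
      qed
      then show ?thesis ..
    qed
  qed
qed

text \<open>A kernel pair meeting \<open>w\<close> would lie in \<open>w\<close>, so here the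
  neighbour relation on \<open>w\<close> is a symmetric graph without isolated vertices on at least
  five points. Either the edge from \<open>x\<close> to \<open>a\<close> extends to three connected
  points, or it is a component and the search continues outside it.\<close>

lemma generated_without_kpair:
  assumes w: "w \<in> A" "w \<inter> rootless = {}" and no: "\<And>P. P \<in> kpairs \<Longrightarrow> \<not> P \<subseteq> w"
  shows "gen4 w \<or> gen5 w \<or> gen6 w"
proof -
  have out: "\<exists>v\<in>w. v \<in> nbrs u \<and> v \<noteq> u" if "u \<in> w" for u
    using nbrs_meets[OF w(1) that] w(2) that by blast
  have "u \<notin> \<Union>kpairs" if "u \<in> w" for u
    using that w(1) no cluster_mem subset_cluster by blast
  then have sym: "u \<in> nbrs v" if "u \<in> w" "v \<in> w" "v \<in> nbrs u" for u v
    using that nbrs_sym by blast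
  obtain x where x: "x \<in> w"
    using fresh_mem[OF w(1), of "[]"] by auto
  obtain a where a: "a \<in> w" "a \<in> nbrs x" "a \<noteq> x"
    using out[OF x] by blast
  show ?thesis
  proof (cases "\<exists>u\<in>w - {x, a}. u \<in> nbrs x \<union> nbrs a")
    case True
    then obtain u where u: "u \<in> w" "u \<noteq> x" "u \<noteq> a" "u \<in> nbrs x \<union> nbrs a"
      by blast
    obtain z where z: "z \<in> w" "z \<notin> set [x, a, u]"
      using fresh_mem[OF w(1), of "[x, a, u]"] by auto
    obtain z' where z': "z' \<in> w" "z' \<in> nbrs z" "z' \<noteq> z"
      using out[OF z(1)] by blast
    show ?thesis
    proof (cases "z' \<in> {x, a, u}")
      case True
      have "z \<in> nbrs z'"
        using sym z z' by blast
      then have "gen4 w"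
        using True x a u z by (intro gen4I[of x a u z]) auto
      then show ?thesis by blast
    next
      case False
      then have "gen5 w"
        using x a u z z' by (intro gen5I[of x a z z' u]) auto
      then show ?thesis by blast
    qed
  next
    case False
    \<comment> \<open>By symmetry, an edge from \<open>u\<close> to \<open>x\<close> or
      \<open>a\<close> would make \<open>u\<close> a neighbour of that point.\<close>
    have away: "\<exists>v\<in>w. v \<in> nbrs u \<and> v \<noteq> u \<and> v \<noteq> x \<and> v \<noteq> a" if "u \<in> w" "u \<noteq> x" "u \<noteq> a" for u
      using out[OF that(1)] sym[OF that(1)] False that x a by blast
    obtain u where u: "u \<in> w" "u \<notin> set [x, a]"
      using fresh_mem[OF w(1), of "[x, a]"] by auto
    obtain u' where u': "u' \<in> w" "u' \<in> nbrs u" "u' \<noteq> u" "u' \<noteq> x" "u' \<noteq> a"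
      using away[of u] u by auto
    obtain z where z: "z \<in> w" "z \<notin> set [x, a, u, u']"
      using fresh_mem[OF w(1), of "[x, a, u, u']"] by auto
    obtain z' where z': "z' \<in> w" "z' \<in> nbrs z" "z' \<noteq> z" "z' \<noteq> x" "z' \<noteq> a"
      using away[of z] z by auto
    show ?thesis
    proof (cases "z' \<in> {u, u'}")
      case True
      have "z \<in> nbrs z'"
        using sym z z' by blast
      then have "gen5 w"
        using True x a u u' z by (intro gen5I[of x a u u' z]) auto
      then show ?thesis by blast
    next
      case False
      then have "gen6 w"
        using x a u u' z z' by (intro gen6I[of x a u u' z z']) auto
      then show ?thesis by blast
    qed
  qed
qed

lemma A_cases:
  assumes "w \<in> A"
  shows "w \<inter> rootless \<noteq> {} \<or> w \<in> central \<or> gen4 w \<or> gen5 w \<or> gen6 w"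
  using assms generated_with_kpair generated_without_kpair by blast

section \<open>Counting the exceptional members\<close>

lemma card_rootless:
  "card {w \<in> A. w \<inter> rootless \<noteq> {}} * n ^ 2
     \<le> (n * (r * (r * r))) * (r ^ 2 * ((n - 2) choose (r - 2)))"
proof -
  \<comment> \<open>For a member v of A through x, any w through x meets v - {x}; blockers then supply two more points of w.\<close>
  define v where "v x = (SOME v. v \<in> A \<and> x \<in> v)" for x
  \<comment> \<open>Intersecting with \<open>\<Union>A\<close> guarantees that the choice
    \<open>v x\<close> exists.\<close>
  define X where "X = rootless \<inter> \<Union>A"
  have v: "v x \<in> A" "x \<in> v x" if "x \<in> X" for x
  proof -
    have "\<exists>v. v \<in> A \<and> x \<in> v"
      using that by (auto simp: X_def)
    from someI_ex[OF this] show "v x \<in> A" "x \<in> v x"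
      by (simp_all add: v_def)
  qed
  have nk: "\<not> kernel {x, y}" if "x \<in> X" "y \<noteq> x" for x y
    using that by (auto simp: X_def rootless_def)
  have nk': "\<not> kernel {x, y, z}" if "x \<in> X" "y \<noteq> x" "z \<noteq> x" "z \<noteq> y" for x y z
    using that by (auto simp: X_def rootless_def)
  have blk: "z \<noteq> x" "z \<noteq> y" if "x \<in> X" "y \<noteq> x" "z \<in> blocker {x, y}" for x y z
    using blocker(3)[OF nk[OF that(1,2)]] that(3) by auto
  let ?I1 = "\<lambda>x y. SIGMA z:blocker {x, y}. blocker {x, y, z}"
  let ?I2 = "\<lambda>x. SIGMA y:v x - {x}. ?I1 x y"
  let ?I = "SIGMA x:X. ?I2 x"
  have I1: "finite (?I1 x y) \<and> card (?I1 x y) \<le> r * r" if "x \<in> X" "y \<noteq> x" for x y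
    using card_Sigma_le[of "blocker {x, y}" r "\<lambda>z. blocker {x, y, z}" r]
      blocker(1,2)[OF nk[OF that]] blocker(1,2)[OF nk'[OF that blk[OF that]]] by auto
  have I2: "finite (?I2 x) \<and> card (?I2 x) \<le> r * (r * r)" if "x \<in> X" for x
  proof -
    have "finite (v x - {x})" "card (v x - {x}) \<le> r"
      using A_memD[OF v(1)[OF that]] card_mono[of "v x" "v x - {x}"] by auto
    then show ?thesis
      using card_Sigma_le[of "v x - {x}" r "?I1 x" "r * r"] I1[OF that] by blast
  qed
  have X: "X \<subseteq> {1..n}"
    by (auto simp: X_def rootless_def)
  then have "finite X" "card X \<le> n"
    using finite_subset[of X "{1..n}"] card_mono[of "{1..n}" X] by auto
  then have I: "finite ?I" "card ?I \<le> n * (r * (r * r))"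
    using card_Sigma_le[of X n ?I2 "r * (r * r)"] I2 by blast+
  have "card {w \<in> A. w \<inter> rootless \<noteq> {}} * n ^ (4 - 2)
          \<le> (n * (r * (r * r))) * (r ^ (4 - 2) * ((n - 2) choose (r - 2)))"
  proof (rule card_rsets_cover[where f = "\<lambda>(x, y, z, u). {x, y, z, u}", OF _ I])
    show "{w \<in> A. w \<inter> rootless \<noteq> {}} \<subseteq> rsets n r"
      using A_rsets by blast
  next
    fix w assume "w \<in> {w \<in> A. w \<inter> rootless \<noteq> {}}"
    then obtain x where w: "w \<in> A" and x: "x \<in> w" "x \<in> X"
      by (auto simp: X_def)
    have "card (v x \<inter> w) \<noteq> 1"
      using A_inter v(1) x w by blast
    moreover have "x \<in> v x \<inter> w"
      using v(2) x by blast
    ultimately have "v x \<inter> w \<noteq> {x}"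
      by auto
    then obtain y where y: "y \<in> v x - {x}" "y \<in> w"
      using \<open>x \<in> v x \<inter> w\<close> by blast
    then have yx: "y \<noteq> x"
      by simp
    obtain z where z: "z \<in> blocker {x, y}" "z \<in> w"
      using blocker(4)[OF nk[OF x(2) yx] w] x y by blast
    note zxy = blk[OF x(2) yx z(1)]
    obtain u where u: "u \<in> blocker {x, y, z}" "u \<in> w"
      using blocker(4)[OF nk'[OF x(2) yx zxy] w] x y z by blast
    have "u \<notin> {x, y, z}"
      using blocker(3)[OF nk'[OF x(2) yx zxy]] u by blast
    then have "card {x, y, z, u} = 4"
      using yx zxy by auto
    then show "\<exists>i\<in>?I. card (case i of (x, y, z, u) \<Rightarrow> {x, y, z, u}) = 4 \<and>
                 (case i of (x, y, z, u) \<Rightarrow> {x, y, z, u}) \<subseteq> w"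
      using x y z u by (intro bexI[of _ "(x, y, z, u)"]) auto
  qed simp
  then show ?thesis by simp
qed

definition edges :: "(nat \<times> nat) set" where
  "edges = (SIGMA x:{1..n}. nbrs x)"

lemma edges: "finite edges" "card edges \<le> n * (3 * r)"
  unfolding edges_def using card_Sigma_le[of "{1..n}" n nbrs "3 * r"] nbrs_finite nbrs_card by auto

lemma edgesI: "w \<in> A \<Longrightarrow> x \<in> w \<Longrightarrow> y \<in> nbrs x \<Longrightarrow> (x, y) \<in> edges"
  using A_memD(1)[of w] by (auto simp: edges_def)

lemma nbrs_Un_card:
  "card (nbrs x \<union> nbrs y) \<le> 6 * r"
  "card (nbrs x \<union> nbrs y \<union> nbrs z) \<le> 9 * r"
  "card (nbrs x \<union> nbrs y \<union> nbrs z \<union> nbrs u) \<le> 12 * r"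
proof -
  show 2: "card (nbrs x \<union> nbrs y) \<le> 6 * r" for x y
    using card_Un_le[of "nbrs x" "nbrs y"] nbrs_card[of x] nbrs_card[of y] by linarith
  show 3: "card (nbrs x \<union> nbrs y \<union> nbrs z) \<le> 9 * r" for z
    using card_Un_le[of "nbrs x \<union> nbrs y" "nbrs z"] 2[of x y] nbrs_card[of z] by linarith
  show "card (nbrs x \<union> nbrs y \<union> nbrs z \<union> nbrs u) \<le> 12 * r"
    using card_Un_le[of "nbrs x \<union> nbrs y \<union> nbrs z" "nbrs u"] 3[of z] nbrs_card[of u] by linarith
qed

text \<open>One free point costs \<open>n\<close>, while four fixed points save
  \<open>n ^ 2\<close>. The later neighbours may come from two and then three earlier points, whence
  \<open>6 * r\<close> and \<open>9 * r\<close>.\<close>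

lemma card_gen4:
  "card {w \<in> A. gen4 w} * n ^ 2
     \<le> (n * (3 * r) * (6 * r * (9 * r))) * (r ^ 2 * ((n - 2) choose (r - 2)))"
proof -
  let ?F = "\<lambda>(x, a). SIGMA b:nbrs x \<union> nbrs a. nbrs x \<union> nbrs a \<union> nbrs b"
  let ?f = "\<lambda>((x, a), b, c). {x, a, b, c}"
  have F: "finite (?F e) \<and> card (?F e) \<le> 6 * r * (9 * r)" for e
    using card_Sigma_le[of "nbrs (fst e) \<union> nbrs (snd e)" "6 * r"
        "\<lambda>b. nbrs (fst e) \<union> nbrs (snd e) \<union> nbrs b" "9 * r"] nbrs_finite nbrs_Un_card
    by (simp add: case_prod_beta)
  have "card {w \<in> A. gen4 w} * n ^ (4 - 2)
          \<le> (n * (3 * r) * (6 * r * (9 * r))) * (r ^ (4 - 2) * ((n - 2) choose (r - 2)))"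
  proof (rule card_rsets_cover[where f = ?f and I = "Sigma edges ?F"])
    show "\<exists>i\<in>Sigma edges ?F. card (?f i) = 4 \<and> ?f i \<subseteq> w" if "w \<in> {w \<in> A. gen4 w}" for w
    proof -
      from that obtain x a b c where *: "card {x, a, b, c} = 4" "{x, a, b, c} \<subseteq> w"
        "a \<in> nbrs x" "b \<in> nbrs x \<union> nbrs a" "c \<in> nbrs x \<union> nbrs a \<union> nbrs b" and w: "w \<in> A"
        by (auto simp: gen4_def)
      then have "(x, a) \<in> edges"
        using edgesI by blast
      then show ?thesis
        using * by (intro bexI[of _ "((x, a), b, c)"]) auto
    qed
  qed (use A_rsets card_Sigma_le[OF edges F] in auto)
  then show ?thesis by simp
qed

text \<open>Two edges cost \<open>n ^ 2\<close> against a saving of \<open>n ^ 3\<close>; the last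
  point is a neighbour of any of four points, whence \<open>12 * r\<close>.\<close>

lemma card_gen5:
  "card {w \<in> A. gen5 w} * n ^ 3
     \<le> (n * (3 * r) * (n * (3 * r) * (12 * r))) * (r ^ 3 * ((n - 2) choose (r - 2)))"
proof -
  let ?G = "\<lambda>(x, a) (y, b). nbrs x \<union> nbrs a \<union> nbrs y \<union> nbrs b"
  let ?F = "\<lambda>e. Sigma edges (?G e)"
  let ?f = "\<lambda>((x, a), (y, b), c). {x, a, y, b, c}"
  have "finite (?G e e') \<and> card (?G e e') \<le> 12 * r" for e e'
    using nbrs_finite nbrs_Un_card by (simp add: case_prod_beta)
  then have F: "finite (?F e) \<and> card (?F e) \<le> n * (3 * r) * (12 * r)" for e
    using card_Sigma_le[OF edges, of "?G e" "12 * r"] by blast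
  have "card {w \<in> A. gen5 w} * n ^ (5 - 2)
     \<le> (n * (3 * r) * (n * (3 * r) * (12 * r))) * (r ^ (5 - 2) * ((n - 2) choose (r - 2)))"
  proof (rule card_rsets_cover[where f = ?f and I = "Sigma edges ?F"])
    show "\<exists>i\<in>Sigma edges ?F. card (?f i) = 5 \<and> ?f i \<subseteq> w" if "w \<in> {w \<in> A. gen5 w}" for w
    proof -
      from that obtain x a y b c where *: "card {x, a, y, b, c} = 5" "{x, a, y, b, c} \<subseteq> w"
        "a \<in> nbrs x" "b \<in> nbrs y" "c \<in> nbrs x \<union> nbrs a \<union> nbrs y \<union> nbrs b" and w: "w \<in> A"
        by (auto simp: gen5_def)
      then have "(x, a) \<in> edges" "(y, b) \<in> edges"
        using edgesI by blast+
      then show ?thesis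
        using * by (intro bexI[of _ "((x, a), (y, b), c)"]) auto
    qed
  qed (use A_rsets card_Sigma_le[OF edges F] in auto)
  then show ?thesis by simp
qed

text \<open>Three independent edges cost \<open>n ^ 3\<close> against a saving of
  \<open>n ^ 4\<close>.\<close>

lemma card_gen6:
  "card {w \<in> A. gen6 w} * n ^ 4
     \<le> (n * (3 * r) * (n * (3 * r) * (n * (3 * r)))) * (r ^ 4 * ((n - 2) choose (r - 2)))"
proof -
  let ?I = "edges \<times> edges \<times> edges"
  let ?f = "\<lambda>((x, a), (y, b), (z, c)). {x, a, y, b, z, c}"
  have I: "finite ?I" "card ?I \<le> n * (3 * r) * (n * (3 * r) * (n * (3 * r)))"
    using mult_le_mono[OF edges(2) mult_le_mono[OF edges(2) edges(2)]] edges(1)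
    by (simp_all add: card_cartesian_product)
  have "card {w \<in> A. gen6 w} * n ^ (6 - 2)
     \<le> (n * (3 * r) * (n * (3 * r) * (n * (3 * r)))) * (r ^ (6 - 2) * ((n - 2) choose (r - 2)))"
  proof (rule card_rsets_cover[where f = ?f and I = ?I, OF _ I])
    show "\<exists>i\<in>?I. card (?f i) = 6 \<and> ?f i \<subseteq> w" if "w \<in> {w \<in> A. gen6 w}" for w
    proof -
      from that obtain x a y b z c where *: "card {x, a, y, b, z, c} = 6"
        "{x, a, y, b, z, c} \<subseteq> w" "a \<in> nbrs x" "b \<in> nbrs y" "c \<in> nbrs z" and w: "w \<in> A"
        by (auto simp: gen6_def)
      then have "(x, a) \<in> edges" "(y, b) \<in> edges" "(z, c) \<in> edges"
        using edgesI by blast+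
      then show ?thesis
        using * by (intro bexI[of _ "((x, a), (y, b), (z, c))"]) auto
    qed
  qed (use A_rsets in auto)
  then show ?thesis by simp
qed

section \<open>The main term and the explicit bound\<close>

text \<open>Each kernel pair contributes at most \<open>?B\<close> times
  \<open>card (cluster P) / (t * n)\<close>: for clusters of at least \<open>t * n\<close> points by
  the bound on stars, for smaller ones by \<open>gbinomial_scaling_le\<close>. The clusters are
  disjoint in \<open>{1..n}\<close>, so these ratios sum to at most \<open>1 / t\<close>.\<close>

lemma card_central:
  assumes t: "0 < t" and dA: "real (dA n A) \<le> (t * real n - 2) gchoose (r - 2)"
  shows "t * real n * real (card central) \<le> real n * ((t * real n - 2) gchoose (r - 2))"
proof -
  let ?B = "(t * real n - 2) gchoose (r - 2)"
  define C where "C P = {w \<in> A. P \<subseteq> w \<and> w \<subseteq> cluster P}" for P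
  have B: "0 \<le> ?B"
    using dA by (meson of_nat_0_le_iff order_trans)
  have fin: "finite (cluster P)" for P
    using cluster_subset finite_subset by blast
  have C: "t * real n * real (card (C P)) \<le> real (card (cluster P)) * ?B" if P: "P \<in> kpairs" for P
  proof (cases "t * real n \<le> real (card (cluster P))")
    case True
    obtain p q where pq: "P = {p, q}" "p \<noteq> q"
      using kpairsD(2)[OF P] by (meson card_2_iff)
    have "p \<in> {1..n}" "q \<in> {1..n}"
      using kernel_subset[OF kpairsD(1)[OF P]] pq by auto
    then have "card {v \<in> A. p \<in> v \<and> q \<in> v} \<le> dA n A"
      using star_card_le_dA[OF finite_A] pq(2) by blast
    moreover have "card (C P) \<le> card {v \<in> A. p \<in> v \<and> q \<in> v}"
      using finite_A pq by (intro card_mono) (auto simp: C_def)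
    ultimately have "real (card (C P)) \<le> ?B"
      using dA by linarith
    then show ?thesis
      using True by (intro mult_mono) auto
  next
    case False
    show ?thesis
    proof (cases "r \<le> card (cluster P)")
      case True
      have "C P \<subseteq> {w. P \<subseteq> w \<and> w \<subseteq> cluster P \<and> card w = r}"
        using A_memD by (auto simp: C_def)
      then have "card (C P) \<le> card {w. P \<subseteq> w \<and> w \<subseteq> cluster P \<and> card w = r}"
        using fin[of P] by (intro card_mono) auto
      also have "\<dots> \<le> (card (cluster P) - 2) choose (r - 2)"
        using card_subsets_between[OF fin subset_cluster[OF P]] kpairsD(2)[OF P] by metis
      finally have "t * real n * real (card (C P))
          \<le> t * real n * real ((card (cluster P) - 2) choose (r - 2))"
        using t by (intro mult_left_mono) auto
      also have "\<dots> \<le> real (card (cluster P)) * ?B"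
        using True False r_ge by (intro gbinomial_scaling_le) auto
      finally show ?thesis .
    next
      case small: False
      have "C P = {}"
      proof (rule ccontr)
        assume "C P \<noteq> {}"
        then obtain w where "w \<in> A" "w \<subseteq> cluster P"
          by (auto simp: C_def)
        then show False
          using small card_mono[OF fin, of w P] A_memD(2) by auto
      qed
      then show ?thesis
        using B by simp
    qed
  qed
  have "central \<subseteq> (\<Union>P\<in>kpairs. C P)"
    by (auto simp: central_def C_def)
  then have "card central \<le> card (\<Union>P\<in>kpairs. C P)"
    using finite_kpairs finite_A by (intro card_mono) (auto simp: C_def)
  also have "\<dots> \<le> (\<Sum>P\<in>kpairs. card (C P))"
    using finite_kpairs by (rule card_UN_le)
  finally have "real (card central) \<le> (\<Sum>P\<in>kpairs. real (card (C P)))"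
    by (metis of_nat_le_iff of_nat_sum)
  then have "t * real n * real (card central) \<le> t * real n * (\<Sum>P\<in>kpairs. real (card (C P)))"
    using t by (intro mult_left_mono) auto
  also have "\<dots> = (\<Sum>P\<in>kpairs. t * real n * real (card (C P)))"
    by (simp add: sum_distrib_left)
  also have "\<dots> \<le> (\<Sum>P\<in>kpairs. real (card (cluster P)) * ?B)"
    using C by (rule sum_mono)
  also have "\<dots> = real (\<Sum>P\<in>kpairs. card (cluster P)) * ?B"
    by (simp add: sum_distrib_right)
  also have "(\<Sum>P\<in>kpairs. card (cluster P)) = card (\<Union>P\<in>kpairs. cluster P)"
    using finite_kpairs fin cluster_disjoint by (intro card_UN_disjoint[symmetric]) auto
  also have "real \<dots> * ?B \<le> real n * ?B"
    using B card_mono[of "{1..n}" "\<Union>P\<in>kpairs. cluster P"] cluster_subset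
    by (intro mult_right_mono) auto
  finally show ?thesis .
qed

lemma card_noncentral:
  "n * card (A - central) \<le> 298 * r ^ 7 * ((n - 2) choose (r - 2))"
proof (cases "n = 0")
  case False
  define D where "D = (n - 2) choose (r - 2)"
  have cancel: "n * c \<le> M" if "c * n ^ Suc k \<le> n ^ k * M" for c k M :: nat
    using that False by (simp add: mult_ac)
  have pw: "r ^ i * D \<le> r ^ 7 * D" if "i \<le> 7" for i
    using that r_ge by (intro mult_le_mono1 power_increasing) auto
  have "A - central \<subseteq> {w \<in> A. w \<inter> rootless \<noteq> {}} \<union> {w \<in> A. gen4 w} \<union> {w \<in> A. gen5 w} \<union> {w \<in> A. gen6 w}"
    using A_cases by blast
  then have "card (A - central) \<le> card ({w \<in> A. w \<inter> rootless \<noteq> {}} \<union> {w \<in> A. gen4 w} \<union> {w \<in> A. gen5 w} \<union> {w \<in> A. gen6 w})"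
    using finite_A by (intro card_mono) auto
  also have "\<dots> \<le> card {w \<in> A. w \<inter> rootless \<noteq> {}} + card {w \<in> A. gen4 w} + card {w \<in> A. gen5 w} + card {w \<in> A. gen6 w}"
    by (meson card_Un_le le_trans add_le_mono1)
  finally have "n * card (A - central) \<le> n * card {w \<in> A. w \<inter> rootless \<noteq> {}} + n * card {w \<in> A. gen4 w}
      + n * card {w \<in> A. gen5 w} + n * card {w \<in> A. gen6 w}"
    by (metis (no_types) distrib_left mult_le_mono2)
  moreover have "n * card {w \<in> A. w \<inter> rootless \<noteq> {}} \<le> r ^ 5 * D"
    using card_rootless by (intro cancel[of _ 1]) (simp add: D_def power_numeral_reduce mult_ac)
  moreover have "n * card {w \<in> A. gen4 w} \<le> 162 * (r ^ 5 * D)"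
    using card_gen4 by (intro cancel[of _ 1]) (simp add: D_def power_numeral_reduce mult_ac)
  moreover have "n * card {w \<in> A. gen5 w} \<le> 108 * (r ^ 6 * D)"
    using card_gen5 by (intro cancel[of _ 2]) (simp add: D_def power_numeral_reduce mult_ac)
  moreover have "n * card {w \<in> A. gen6 w} \<le> 27 * (r ^ 7 * D)"
    using card_gen6 by (intro cancel[of _ 3]) (simp add: D_def power_numeral_reduce mult_ac)
  \<comment> \<open>The constant is \<open>1 + 162 + 108 + 27\<close>, after all powers of
    \<open>r\<close> are raised to the seventh.\<close>
  ultimately have "n * card (A - central) \<le> 298 * (r ^ 7 * D)"
    using pw[of 5] pw[of 6] by linarith
  then show ?thesis
    by (simp add: D_def mult.assoc)
qed simp

text \<open>A nonempty \<open>A\<close> forces \<open>n \<ge> 5\<close>, where the generalized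
  binomial is the ordinary one. The absolute value keeps the error nonnegative for
  \<open>n < 2\<close> as well, which settles empty \<open>A\<close>.\<close>

lemma card_bound:
  assumes t: "0 < t" and dA: "real (dA n A) \<le> (t * real n - 2) gchoose (r - 2)"
  shows "real (card A) \<le> (1 / t) * ((t * real n - 2) gchoose (r - 2))
           + 298 * real r ^ 7 / real n * \<bar>(real n - 2) gchoose (r - 2)\<bar>"
proof (cases "A = {}")
  case True
  have "0 \<le> (t * real n - 2) gchoose (r - 2)"
    using dA by (meson of_nat_0_le_iff order_trans)
  then show ?thesis
    using True t by simp
next
  case False
  then obtain w where "w \<in> A"
    by blast
  then have n: "5 \<le> n"
    using A_memD(1,2)[of w] r_ge card_mono[of "{1..n}" w] by simp
  let ?B = "(t * real n - 2) gchoose (r - 2)"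
  have D: "(real n - 2) gchoose (r - 2) = real ((n - 2) choose (r - 2))"
    using n by (simp add: binomial_gbinomial of_nat_diff)
  have "card A = card central + card (A - central)"
    using finite_A card_Un_disjoint[of central "A - central"] finite_subset[of central A]
    by (simp add: central_def Un_absorb1)
  moreover have "real (card central) \<le> 1 / t * ?B"
    using card_central[OF assms] t n by (simp add: field_simps)
  moreover have "real (n * card (A - central)) \<le> real (298 * r ^ 7 * ((n - 2) choose (r - 2)))"
    using card_noncentral of_nat_le_iff by blast
  then have "real (card (A - central)) \<le> 298 * real r ^ 7 / real n * real ((n - 2) choose (r - 2))"
    using n by (simp add: field_simps)
  ultimately show ?thesis
    by (simp add: D)
qed

end

section \<open>Passage to the asymptotic statement\<close>

theorem theorem5:
  fixes r :: "nat \<Rightarrow> nat"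
  assumes r_ge: "\<And>n. r n \<ge> 5"
    and r_small: "(\<lambda>n. real (r n)) \<in> o(\<lambda>n. real n powr (1/8))"
  shows "\<exists>e :: nat \<Rightarrow> real.
           e \<in> o(\<lambda>n. (real n - 2) gchoose (r n - 2)) \<and>
           (\<forall>n t A. 0 < t \<and> t < 1 \<and> indep_Gnr1 n (r n) A \<and>
              real (dA n A) \<le> (t * real n - 2) gchoose (r n - 2) \<longrightarrow>
              real (card A) \<le> (1 / t) * ((t * real n - 2) gchoose (r n - 2)) + e n)"
proof (intro exI conjI allI impI)
  let ?D = "\<lambda>n. (real n - 2) gchoose (r n - 2)"
  \<comment> \<open>The error term of \<open>card_bound\<close>, which involves neither
    \<open>t\<close> nor \<open>A\<close>.\<close>
  let ?e = "\<lambda>n. 298 * real (r n) ^ 7 / real n * \<bar>?D n\<bar>"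
  \<comment> \<open>The eighth power turns the growth condition into \<open>r ^ 8 = o(n)\<close>,
    and \<open>r ^ 7 \<le> r ^ 8\<close>.\<close>
  have "(\<lambda>n. real (r n) ^ 8) \<in> o(\<lambda>n. (real n powr (1/8)) ^ 8)"
    using landau_o.small_power[OF r_small, of 8] by simp
  moreover have "(\<lambda>n. real (r n) ^ 7) \<in> O(\<lambda>n. real (r n) ^ 8)"
    using r_ge by (intro bigoI[of _ 1] always_eventually allI)
      (auto intro!: power_increasing order_trans[OF _ of_nat_mono[OF r_ge]])
  ultimately have "(\<lambda>n. real (r n) ^ 7) \<in> o(\<lambda>n. (real n powr (1/8)) ^ 8)"
    by (rule landau_o.big_small_trans[rotated])
  moreover have "(real n powr (1/8)) ^ 8 = real n" for n
    by (cases "n = 0") (simp_all add: powr_power)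
  ultimately have "(\<lambda>n. real (r n) ^ 7) \<in> o(\<lambda>n. real n)"
    by simp
  then have "((\<lambda>n. 298 * (real (r n) ^ 7 / real n)) \<longlongrightarrow> 298 * 0) sequentially"
    by (intro tendsto_intros smalloD_tendsto)
  then have "(\<lambda>n. 298 * real (r n) ^ 7 / real n) \<in> o(\<lambda>n. 1)"
    by (intro smalloI_tendsto) auto
  from landau_o.small_big_mult[OF this, of "\<lambda>n. \<bar>?D n\<bar>" ?D] show "?e \<in> o(?D)"
    by simp
  fix n t A
  assume *: "0 < t \<and> t < 1 \<and> indep_Gnr1 n (r n) A \<and>
    real (dA n A) \<le> (t * real n - 2) gchoose (r n - 2)"
  then interpret indep_family n "r n" A
    using r_ge by unfold_locales auto
  show "real (card A) \<le> (1 / t) * ((t * real n - 2) gchoose (r n - 2)) + ?e n"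
    using card_bound * by blast
qed

end
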